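(* Let $n,m,d\ge 1$, let $\mathbf{P}\subset\mathbb{R}^d$ be a nonempty compact set with $\overline{\operatorname{int}\mathbf{P}}=\mathbf{P}$, and let $A\in C(\mathbf{P},\mathbb{R}^{n\times n})$ and $B\in C(\mathbf{P},\mathbb{R}^{n\times m})$. Let $b_1(\theta),\ldots,b_m(\theta)$ denote the columns of $B(\theta)$. The following assertions are equivalent. (a) The continuous-time ensemble $\tfrac{\partial}{\partial t}x(t,\theta)=A(\theta)x(t,\theta)+B(\theta)u(t)$, $x(0,\theta)=0$, $\theta\in\mathbf{P}$, is uniformly ensemble controllable. (b) The discrete-time ensemble $x_{t+1}(\theta)=A(\theta)x_t(\theta)+B(\theta)u_t$, $x_0(\theta)=0$, $\theta\in\mathbf{P}$, is uniformly ensemble controllable. (c) For each $\varepsilon>0$ and each $x^*\in C(\mathbf{P},\mathbb{R}^n)$ there exist real scalar polynomials $p_1,\ldots,p_m\in\mathbb{R}[z]$ such that $$\sup_{\theta\in\mathbf{P}}\Big\|\sum_{j=1}^m p_j(A(\theta))\,b_j(\theta)-x^*(\theta)\Big\|<\varepsilon .$$ (d) The set $\operatorname{span}\{A(\theta)^k b_j(\theta)\;|\;k\in\mathbb{N}_0,\ j=1,\ldots,m\}$ of continuous functions in $\theta$ is dense in $C(\mathbf{P},\mathbb{R}^n)$ with respect to the sup-norm.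
   Context: $C(\mathbf{P},X)$ denotes the continuous functions from $\mathbf{P}$ to $X$; the span is the real linear span. Continuous-time uniform ensemble controllability: for every $x^*\in C(\mathbf{P},\mathbb{R}^n)$ and every $\varepsilon>0$ there exist $T>0$ and an input $u\in L^1([0,T],\mathbb{R}^m)$, independent of $\theta$, such that $\sup_{\theta\in\mathbf{P}}\|\varphi(T,\theta,u)-x^*(\theta)\|<\varepsilon$, where $\varphi(T,\theta,u)=\int_0^T e^{A(\theta)(T-s)}B(\theta)u(s)\,ds$. Discrete-time uniform ensemble controllability: for every $x^*\in C(\mathbf{P},\mathbb{R}^n)$ and every $\varepsilon>0$ there exist a positive integer $T$ and a finite input sequence $u_0,\ldots,u_{T-1}\in\mathbb{R}^m$, independent of $\theta$, such that $\sup_{\theta\in\mathbf{P}}\|\varphi(T,\theta,u)-x^*(\theta)\|<\varepsilon$, where $\varphi(T,\theta,u)=\sum_{k=0}^{T-1}A(\theta)^kB(\theta)u_{T-1-k}$. *)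

theory Defs
  imports
    "HOL-Analysis.Analysis"
    "HOL-Library.Function_Algebras"
    "HOL-Computational_Algebra.Polynomial"
begin

text \<open>Matrices \<open>real^'n^'n\<close> carry no type-class ring structure for \<open>**\<close>, so the library's
  \<open>exp\<close> and \<open>poly\<close> do not apply to them.\<close>

primrec mat_pow :: "real^'n^'n \<Rightarrow> nat \<Rightarrow> real^'n^'n" where
  "mat_pow M 0 = mat 1"
| "mat_pow M (Suc k) = M ** mat_pow M k"

definition mat_exp :: "real^'n^'n \<Rightarrow> real^'n^'n" where
  "mat_exp M = (\<Sum>k. (1 / fact k) *\<^sub>R mat_pow M k)"

definition mat_poly :: "real poly \<Rightarrow> real^'n^'n \<Rightarrow> real^'n^'n" where
  "mat_poly p M = (\<Sum>i\<le>degree p. coeff p i *\<^sub>R mat_pow M i)"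


definition ct_state ::
  "('p \<Rightarrow> real^'n^'n) \<Rightarrow> ('p \<Rightarrow> real^'m^'n) \<Rightarrow> real \<Rightarrow> (real \<Rightarrow> real^'m) \<Rightarrow> 'p \<Rightarrow> real^'n" where
  "ct_state A B T u \<theta> =
     (LINT s:{0..T}|lebesgue. mat_exp ((T - s) *\<^sub>R A \<theta>) *v (B \<theta> *v u s))"

definition ct_uniformly_ensemble_controllable ::
  "'p::topological_space set \<Rightarrow> ('p \<Rightarrow> real^'n^'n) \<Rightarrow> ('p \<Rightarrow> real^'m^'n) \<Rightarrow> bool" where
  "ct_uniformly_ensemble_controllable P A B \<longleftrightarrow>
     (\<forall>xs. continuous_on P xs \<longrightarrow> (\<forall>\<epsilon>>0.
        \<exists>T>0. \<exists>u. u absolutely_integrable_on {0..T} \<and>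
          (SUP \<theta>\<in>P. norm (ct_state A B T u \<theta> - xs \<theta>)) < \<epsilon>))"

definition dt_state ::
  "('p \<Rightarrow> real^'n^'n) \<Rightarrow> ('p \<Rightarrow> real^'m^'n) \<Rightarrow> nat \<Rightarrow> (nat \<Rightarrow> real^'m) \<Rightarrow> 'p \<Rightarrow> real^'n" where
  "dt_state A B T u \<theta> = (\<Sum>k<T. mat_pow (A \<theta>) k *v (B \<theta> *v u (T - 1 - k)))"

text \<open>Only the values \<open>u 0, \<dots>, u (T - 1)\<close> of the input sequence are used.\<close>

definition dt_uniformly_ensemble_controllable ::
  "'p::topological_space set \<Rightarrow> ('p \<Rightarrow> real^'n^'n) \<Rightarrow> ('p \<Rightarrow> real^'m^'n) \<Rightarrow> bool" where
  "dt_uniformly_ensemble_controllable P A B \<longleftrightarrow>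
     (\<forall>xs. continuous_on P xs \<longrightarrow> (\<forall>\<epsilon>>0.
        \<exists>T>0. \<exists>u. (SUP \<theta>\<in>P. norm (dt_state A B T u \<theta> - xs \<theta>)) < \<epsilon>))"


text \<open>Pointwise scalar multiplication, so that the library's \<open>span\<close> is the real linear span
  in a space of functions.\<close>

instantiation "fun" :: (type, real_vector) real_vector
begin

definition scaleR_fun :: "real \<Rightarrow> ('a \<Rightarrow> 'b) \<Rightarrow> 'a \<Rightarrow> 'b" where
  "scaleR_fun c f = (\<lambda>x. c *\<^sub>R f x)"

instance
  by standard (simp_all add: scaleR_fun_def plus_fun_def scaleR_add_right scaleR_add_left)

end

text \<open>The metric space of continuous functions from \<open>P\<close> to \<open>'b\<close> with the supremum metric. As
  elements of \<^const>\<open>cfunspace\<close>, functions on \<open>P\<close> are represented extensionally (\<open>undefined\<close>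
  off \<open>P\<close>). The next two facts unfold it for compact \<open>P\<close>.\<close>

abbreviation cont_space ::
  "'p::topological_space set \<Rightarrow> ('p \<Rightarrow> 'b::metric_space) metric" where
  "cont_space P \<equiv> cfunspace (top_of_set P) euclidean_metric"

lemma mspace_cont_space:
  assumes "compact P"
  shows "mspace (cont_space P) = {f \<in> extensional P. continuous_on P f}"
proof -
  have "bounded (f ` P)" if "continuous_on P f" for f :: "'a \<Rightarrow> 'b"
    using assms that compact_continuous_image compact_imp_bounded by blast
  then show ?thesis
    by (auto simp: mtopology_of_def)
qed

lemma mdist_cont_space:
  assumes "compact P" "P \<noteq> {}" "f \<in> mspace (cont_space P)" "g \<in> mspace (cont_space P)"
  shows "mdist (cont_space P) f g = (SUP \<theta>\<in>P. dist (f \<theta>) (g \<theta>))"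
  using assms by (auto simp: cfunspace_def mdist_submetric mdist_funspace Met_TC.fdist_def Met_TC.fspace_def)

end

theory Submission
  imports Defs
begin

text \<open>Each of the four assertions says that every continuous function on \<open>P\<close> lies in the uniform
  closure of a set of functions, and for (b), (c) and (d) this set is the same span of the
  \<open>A\<^sup>k b\<^sub>j\<close>. For (a), expanding the exponential writes a reachable state as
  \<open>\<Sum>k. A\<^sup>k B w\<^sub>k\<close> with \<open>w\<^sub>k\<close> \<open>1 / k!\<close> times a \<open>k\<close>-th moment of the input, uniformly on \<open>P\<close>, so it lies in
  the closure of the span. Conversely, the input that vanishes on \<open>[0, 1 - t]\<close> and equals \<open>v\<close> on
  \<open>[1 - t, 1]\<close> reaches \<open>\<Sum>k. t\<^sup>k\<^sup>+\<^sup>1 / (k + 1)! A\<^sup>k B v\<close>; since this holds for all small \<open>t\<close> and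
  the closure of the states reachable at time 1 is a closed subspace, it contains every coefficient
  of the power series.\<close>

section \<open>Uniform closure of a set of functions\<close>

lemma sum_fun_eq: "(\<lambda>\<theta>. \<Sum>i\<in>I. f i \<theta>) = sum f I"
  by (induction I rule: infinite_finite_induct) (auto simp: fun_eq_iff)

definition uniform_closure ::
  "'p set \<Rightarrow> ('p \<Rightarrow> 'b::real_normed_vector) set \<Rightarrow> ('p \<Rightarrow> 'b) set" where
  "uniform_closure P S = {f. \<forall>e>0. \<exists>g\<in>S. \<forall>\<theta>\<in>P. norm (g \<theta> - f \<theta>) < e}"

lemma uniform_closureI:
  assumes "\<And>e. e > 0 \<Longrightarrow> \<exists>g\<in>S. \<forall>\<theta>\<in>P. norm (g \<theta> - f \<theta>) < e"
  shows "f \<in> uniform_closure P S"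
  using assms by (auto simp: uniform_closure_def)

lemma uniform_closureD:
  assumes "f \<in> uniform_closure P S" "e > 0"
  obtains g where "g \<in> S" "\<And>\<theta>. \<theta> \<in> P \<Longrightarrow> norm (g \<theta> - f \<theta>) < e"
  using assms by (auto simp: uniform_closure_def)

lemma uniform_closure_superset: "S \<subseteq> uniform_closure P S"
  by (force intro: uniform_closureI)

text \<open>With \<open>S\<close> the closure of \<open>S'\<close> this is idempotence of the
  closure; with \<open>S\<close> contained in \<open>S'\<close> it is monotonicity. Both uses occur
  below.\<close>

lemma uniform_closure_minimal:
  assumes "S \<subseteq> uniform_closure P S'"
  shows "uniform_closure P S \<subseteq> uniform_closure P S'"
proof (intro subsetI uniform_closureI)
  fix f and e :: real assume "f \<in> uniform_closure P S" "e > 0"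
  then obtain g where g: "g \<in> S" "\<And>\<theta>. \<theta> \<in> P \<Longrightarrow> norm (g \<theta> - f \<theta>) < e/2"
    by (metis half_gt_zero uniform_closureD)
  then obtain h where h: "h \<in> S'" "\<And>\<theta>. \<theta> \<in> P \<Longrightarrow> norm (h \<theta> - g \<theta>) < e/2"
    by (metis assms \<open>e > 0\<close> half_gt_zero subsetD uniform_closureD)
  have "norm (h \<theta> - f \<theta>) < e" if "\<theta> \<in> P" for \<theta>
    using norm_triangle_lt[of "h \<theta> - g \<theta>" "g \<theta> - f \<theta>" e] g(2)[OF that] h(2)[OF that] by simp
  then show "\<exists>g\<in>S'. \<forall>\<theta>\<in>P. norm (g \<theta> - f \<theta>) < e"
    using h(1) by blast
qed

lemma subspace_uniform_closure:
  assumes "subspace S"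
  shows "subspace (uniform_closure P S)"
  unfolding subspace_def
proof (intro conjI ballI allI)
  show "0 \<in> uniform_closure P S"
    using assms uniform_closure_superset subspace_0 by blast
next
  fix f g assume fg: "f \<in> uniform_closure P S" "g \<in> uniform_closure P S"
  show "f + g \<in> uniform_closure P S"
  proof (rule uniform_closureI)
    fix e :: real assume "e > 0"
    then obtain f' g' where f': "f' \<in> S" "\<And>\<theta>. \<theta> \<in> P \<Longrightarrow> norm (f' \<theta> - f \<theta>) < e/2"
      and g': "g' \<in> S" "\<And>\<theta>. \<theta> \<in> P \<Longrightarrow> norm (g' \<theta> - g \<theta>) < e/2"
      using fg by (metis half_gt_zero uniform_closureD)
    have "norm ((f' + g') \<theta> - (f + g) \<theta>) < e" if "\<theta> \<in> P" for \<theta>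
      using norm_triangle_lt[of "f' \<theta> - f \<theta>" "g' \<theta> - g \<theta>" e] f'(2)[OF that] g'(2)[OF that]
      by (simp add: algebra_simps)
    then show "\<exists>h\<in>S. \<forall>\<theta>\<in>P. norm (h \<theta> - (f + g) \<theta>) < e"
      using subspace_add[OF assms f'(1) g'(1)] by blast
  qed
next
  fix c :: real and f assume f: "f \<in> uniform_closure P S"
  show "c *\<^sub>R f \<in> uniform_closure P S"
  proof (rule uniform_closureI)
    fix e :: real assume "e > 0"
    \<comment> \<open>Adding 1 keeps the denominator positive when \<open>c = 0\<close>.\<close>
    then have "e / (\<bar>c\<bar> + 1) > 0" by simp
    then obtain f' where f': "f' \<in> S" "\<And>\<theta>. \<theta> \<in> P \<Longrightarrow> norm (f' \<theta> - f \<theta>) < e / (\<bar>c\<bar> + 1)"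
      using f by (metis uniform_closureD)
    have "norm ((c *\<^sub>R f') \<theta> - (c *\<^sub>R f) \<theta>) < e" if "\<theta> \<in> P" for \<theta>
    proof -
      have "norm ((c *\<^sub>R f') \<theta> - (c *\<^sub>R f) \<theta>) = \<bar>c\<bar> * norm (f' \<theta> - f \<theta>)"
        by (simp add: scaleR_fun_def flip: scaleR_diff_right)
      also have "\<dots> \<le> \<bar>c\<bar> * (e / (\<bar>c\<bar> + 1))"
        using f'(2)[OF that] by (intro mult_left_mono) auto
      also have "\<dots> < e"
        using \<open>e > 0\<close> by (simp add: field_simps)
      finally show ?thesis .
    qed
    then show "\<exists>h\<in>S. \<forall>\<theta>\<in>P. norm (h \<theta> - (c *\<^sub>R f) \<theta>) < e"
      using subspace_scale[OF assms f'(1)] by blast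
  qed
qed

text \<open>The partial sums belong to \<open>S\<close>, and the Weierstrass M-test makes them
  converge uniformly on \<open>P\<close>.\<close>

lemma uniform_closure_suminf:
  fixes f :: "nat \<Rightarrow> 'p \<Rightarrow> 'b::banach"
  assumes S: "subspace S" "\<And>i. f i \<in> S"
    and M: "\<And>i \<theta>. \<theta> \<in> P \<Longrightarrow> norm (f i \<theta>) \<le> M i" "summable M"
    and g: "\<And>\<theta>. \<theta> \<in> P \<Longrightarrow> g \<theta> = (\<Sum>i. f i \<theta>)"
  shows "g \<in> uniform_closure P S"
proof (rule uniform_closureI)
  fix e :: real assume "e > 0"
  have "uniform_limit P (\<lambda>n \<theta>. \<Sum>i<n. f i \<theta>) (\<lambda>\<theta>. \<Sum>i. f i \<theta>) sequentially"
    using M by (rule Weierstrass_m_test)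
  then obtain n where n: "\<forall>\<theta>\<in>P. dist (\<Sum>i<n. f i \<theta>) (\<Sum>i. f i \<theta>) < e"
    using eventually_happens'[OF sequentially_bot uniform_limitD] \<open>e > 0\<close> by blast
  have "(\<lambda>\<theta>. \<Sum>i<n. f i \<theta>) \<in> S"
    unfolding sum_fun_eq by (intro subspace_sum S)
  then show "\<exists>h\<in>S. \<forall>\<theta>\<in>P. norm (h \<theta> - g \<theta>) < e"
    using n g by (intro bexI[of _ "\<lambda>\<theta>. \<Sum>i<n. f i \<theta>"]) (auto simp: dist_norm)
qed

text \<open>Serves the continuous-time states: they are uniform limits of functions bounded on
  \<open>P\<close>, and the \<open>SUP\<close> in assertion (a) is a true supremum only for
  functions bounded above.\<close>

lemma bounded_uniform_closure:
  assumes "f \<in> uniform_closure P S" "\<And>g. g \<in> S \<Longrightarrow> bounded (g ` P)"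
  shows "bounded (f ` P)"
proof -
  obtain g where g: "g \<in> S" "\<And>\<theta>. \<theta> \<in> P \<Longrightarrow> norm (g \<theta> - f \<theta>) < 1"
    using uniform_closureD[OF assms(1) zero_less_one] by blast
  then obtain c where c: "\<And>\<theta>. \<theta> \<in> P \<Longrightarrow> norm (g \<theta>) \<le> c"
    using assms(2)[OF g(1)] by (auto simp: bounded_iff)
  have "norm (f \<theta>) \<le> c + 1" if "\<theta> \<in> P" for \<theta>
    using norm_triangle_ineq4[of "g \<theta>" "g \<theta> - f \<theta>"] g(2)[OF that] c[OF that] by simp
  then show ?thesis
    by (auto simp: bounded_iff)
qed

text \<open>Once the lower coefficients are known to lie in the closure, subtract their terms, divide by
  \<open>t ^ i\<close>, and let \<open>t\<close> tend to \<open>0\<close>.\<close>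

lemma power_series_coeffs_in_uniform_closure:
  fixes c :: "nat \<Rightarrow> 'p \<Rightarrow> 'b::banach"
  assumes S: "subspace S"
    and M: "\<And>i \<theta>. \<theta> \<in> P \<Longrightarrow> norm (c i \<theta>) \<le> M i" "summable M"
    and F: "\<And>t \<theta>. 0 < t \<Longrightarrow> t \<le> 1 \<Longrightarrow> \<theta> \<in> P \<Longrightarrow> (\<lambda>i. t ^ i *\<^sub>R c i \<theta>) sums F t \<theta>"
    and FS: "\<And>t. 0 < t \<Longrightarrow> t \<le> 1 \<Longrightarrow> F t \<in> S"
  shows "c i \<in> uniform_closure P S"
\<comment> \<open>For empty \<open>P\<close> nothing bounds \<open>M\<close> from below; otherwise
  each \<open>M i\<close> dominates a norm and is nonnegative.\<close>
proof (cases "P = {}")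
  case True
  then show ?thesis
    using subspace_0[OF S] by (auto simp: uniform_closure_def)
next
  case False
  have M0: "0 \<le> M i" for i
    using M(1) False by (meson all_not_in_conv norm_ge_zero order_trans)
  show ?thesis
  proof (induction i rule: less_induct)
    case (less i)
    let ?V = "uniform_closure P S"
    have V: "subspace ?V"
      by (rule subspace_uniform_closure[OF S])
    \<comment> \<open>The lower coefficients are known only to lie in \<open>?V\<close>, so the
      approximants are taken from \<open>?V\<close>; idempotence then removes the second
      closure.\<close>
    have "c i \<in> uniform_closure P ?V"
    proof (rule uniform_closureI)
      fix e :: real assume "e > 0"
      define m where "m = (\<Sum>j. M j)"
      have "m \<ge> 0"
        unfolding m_def using M M0 by (intro suminf_nonneg)
      \<comment> \<open>The cap at 1 bounds the powers of \<open>t\<close> and keeps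
        \<open>F t\<close> available; \<open>m + 1\<close> is positive even if \<open>m = 0\<close>
        and gives \<open>t * m < e\<close>.\<close>
      define t where "t = min 1 (e / (m + 1))"
      have t: "0 < t" "t \<le> 1" "t * m < e"
      proof -
        show "0 < t" "t \<le> 1"
          using \<open>e > 0\<close> \<open>m \<ge> 0\<close> by (auto simp: t_def)
        have "t * m \<le> e / (m + 1) * m"
          using \<open>m \<ge> 0\<close> by (intro mult_right_mono) (auto simp: t_def)
        also have "\<dots> < e"
          using \<open>e > 0\<close> \<open>m \<ge> 0\<close> by (simp add: field_simps)
        finally show "t * m < e" .
      qed
      \<comment> \<open>On \<open>P\<close> this is the series of the terms
        \<open>t ^ j *\<^sub>R c (j + i)\<close>. Its leading term is \<open>c i\<close>, and every
        other term carries a factor \<open>t\<close>.\<close>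
      define g where "g = (1 / t ^ i) *\<^sub>R (F t - (\<Sum>j<i. t ^ j *\<^sub>R c j))"
      have "g \<in> ?V"
        unfolding g_def using less.IH FS[OF t(1,2)] uniform_closure_superset[of S P]
        by (intro subspace_scale subspace_diff subspace_sum V) auto
      moreover have "norm (g \<theta> - c i \<theta>) < e" if \<theta>: "\<theta> \<in> P" for \<theta>
      proof -
        have "g \<theta> = (1 / t ^ i) *\<^sub>R (F t \<theta> - (\<Sum>j<i. t ^ j *\<^sub>R c j \<theta>))"
          by (simp add: g_def scaleR_fun_def sum_fun_eq[symmetric])
        moreover have "(\<lambda>j. (1 / t ^ i) *\<^sub>R (t ^ (j + i) *\<^sub>R c (j + i) \<theta>)) sums
            ((1 / t ^ i) *\<^sub>R (F t \<theta> - (\<Sum>j<i. t ^ j *\<^sub>R c j \<theta>)))"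
          using F[OF t(1,2) \<theta>] by (intro sums_scaleR_right) (rule sums_split_initial_segment)
        ultimately have "(\<lambda>j. t ^ j *\<^sub>R c (j + i) \<theta>) sums g \<theta>"
          using t(1) by (simp add: power_add)
        then have s: "(\<lambda>j. t ^ Suc j *\<^sub>R c (Suc j + i) \<theta>) sums (g \<theta> - c i \<theta>)"
          using sums_split_initial_segment[of _ _ 1] by fastforce
        have "norm (t ^ Suc j *\<^sub>R c (Suc j + i) \<theta>) \<le> t * M (j + Suc i)" for j
        proof -
          have "t ^ Suc j * norm (c (Suc j + i) \<theta>) \<le> t * M (j + Suc i)"
            using M(1)[OF \<theta>, of "Suc j + i"] t power_le_one[of t j]
            by (intro mult_mono) (auto simp: mult_left_le)
          then show ?thesis
            using t by simp
        qed
        then have "norm (g \<theta> - c i \<theta>) \<le> (\<Sum>j. t * M (j + Suc i))"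
          unfolding sums_unique[OF s]
          by (intro norm_suminf_le summable_mult summable_ignore_initial_segment M(2))
        also have "\<dots> = t * (\<Sum>j. M (j + Suc i))"
          by (intro suminf_mult summable_ignore_initial_segment M(2))
        also have "\<dots> \<le> t * m"
          unfolding m_def using t M0 suminf_split_initial_segment[OF M(2), of "Suc i"]
          by (intro mult_left_mono) (auto simp: sum_nonneg)
        also have "\<dots> < e"
          by (rule t(3))
        finally show ?thesis .
      qed
      ultimately show "\<exists>g\<in>?V. \<forall>\<theta>\<in>P. norm (g \<theta> - c i \<theta>) < e"
        by blast
    qed
    then show "c i \<in> ?V"
      using uniform_closure_minimal[of ?V P S] by blast
  qed
qed

section \<open>Suprema over \<open>P\<close> and the supremum metric in terms of the uniform
  closure\<close>

lemma SUP_less_iff_uniform: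
  fixes h :: "'a \<Rightarrow> 'p \<Rightarrow> real"
  assumes "P \<noteq> {}" and "\<And>x. x \<in> X \<Longrightarrow> bdd_above (h x ` P)"
  shows "(\<forall>e>0. \<exists>x\<in>X. (SUP \<theta>\<in>P. h x \<theta>) < e) \<longleftrightarrow> (\<forall>e>0. \<exists>x\<in>X. \<forall>\<theta>\<in>P. h x \<theta> < e)"
    (is "?l \<longleftrightarrow> ?r")
proof
  assume ?l
  then show ?r
    by (meson assms(2) cSUP_upper le_less_trans)
next
  assume r: ?r
  show ?l
  proof (intro allI impI)
    fix e :: real assume "e > 0"
    \<comment> \<open>The supremum of values below a number may equal that number, hence half of
      \<open>e\<close>.\<close>
    then obtain x where x: "x \<in> X" "\<forall>\<theta>\<in>P. h x \<theta> < e/2"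
      using r half_gt_zero by blast
    have "(SUP \<theta>\<in>P. h x \<theta>) \<le> e/2"
      using x(2) assms(1) by (intro cSUP_least) (auto intro: less_imp_le)
    then show "\<exists>x\<in>X. (SUP \<theta>\<in>P. h x \<theta>) < e"
      using x(1) \<open>e > 0\<close> by (intro bexI[of _ x]) auto
  qed
qed

lemma bdd_above_norm_diff:
  fixes f g :: "'p \<Rightarrow> 'b::real_normed_vector"
  assumes "bounded (f ` P)" "bounded (g ` P)"
  shows "bdd_above ((\<lambda>\<theta>. norm (f \<theta> - g \<theta>)) ` P)"
proof -
  obtain c d where "\<And>\<theta>. \<theta> \<in> P \<Longrightarrow> norm (f \<theta>) \<le> c" "\<And>\<theta>. \<theta> \<in> P \<Longrightarrow> norm (g \<theta>) \<le> d"
    using assms by (auto simp: bounded_iff)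
  then show ?thesis
    by (intro bdd_aboveI2[of _ _ "c + d"]) (meson add_mono norm_triangle_ineq4 order_trans)
qed

text \<open>Bounds on \<open>f\<close> and on each \<open>g\<close> make the set under the
  \<open>SUP\<close> bounded above, so that the \<open>SUP\<close> dominates the pointwise
  errors.\<close>

lemma SUP_approx_iff_uniform_closure:
  fixes S :: "('p::topological_space \<Rightarrow> 'b::real_normed_vector) set"
  assumes "compact P" "P \<noteq> {}" "continuous_on P f" and "\<And>g. g \<in> S \<Longrightarrow> bounded (g ` P)"
  shows "(\<forall>e>0. \<exists>g\<in>S. (SUP \<theta>\<in>P. norm (g \<theta> - f \<theta>)) < e) \<longleftrightarrow> f \<in> uniform_closure P S"
proof -
  have "bounded (f ` P)"
    using assms compact_continuous_image compact_imp_bounded by blast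
  then show ?thesis
    unfolding uniform_closure_def mem_Collect_eq
    by (intro SUP_less_iff_uniform[OF assms(2)] bdd_above_norm_diff[OF assms(4)])
qed

text \<open>Brings assertion (d) into the form used for the other three. Points of the metric space
  are extensional, but the uniform closure sees only values on \<open>P\<close>, so
  \<open>restrict\<close> does not affect membership.\<close>

lemma closure_of_cont_space_eq_iff:
  fixes S :: "('p::topological_space \<Rightarrow> 'b::real_normed_vector) set"
  assumes "compact P" "P \<noteq> {}" and S: "\<And>g. g \<in> S \<Longrightarrow> continuous_on P g"
  shows "mtopology_of (cont_space P) closure_of ((\<lambda>f. restrict f P) ` S) = mspace (cont_space P)
    \<longleftrightarrow> {f. continuous_on P f} \<subseteq> uniform_closure P S" (is "?cl = ?M \<longleftrightarrow> _")
proof -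
  have M: "?M = {f \<in> extensional P. continuous_on P f}"
    by (rule mspace_cont_space[OF assms(1)])
  have restrict_M: "restrict g P \<in> ?M" if "continuous_on P g" for g :: "'p \<Rightarrow> 'b"
    using that unfolding M by (auto cong: continuous_on_cong)
  have cl: "f \<in> ?cl \<longleftrightarrow> f \<in> uniform_closure P S" if f: "f \<in> ?M" for f
  proof -
    have bdd: "bounded (g ` P)" if "continuous_on P g" for g :: "'p \<Rightarrow> 'b"
      using that assms compact_continuous_image compact_imp_bounded by blast
    have "f \<in> ?cl \<longleftrightarrow> (\<forall>r>0. \<exists>g\<in>S. mdist (cont_space P) (restrict g P) f < r)"
    proof -
      have "f \<in> ?cl \<longleftrightarrow> f \<in> ?M \<and> (\<forall>r>0. \<exists>g\<in>S. f \<in> ?M \<and> restrict g P \<in> ?M \<and>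
          mdist (cont_space P) f (restrict g P) < r)"
        unfolding mtopology_of_def Metric_space.metric_closure_of[OF Metric_space_mspace_mdist]
          Metric_space.in_mball[OF Metric_space_mspace_mdist] bex_simps(7) by (rule mem_Collect_eq)
      then show ?thesis
        using f restrict_M[OF S] mdist_commute by metis
    qed
    also have "\<dots> \<longleftrightarrow> (\<forall>r>0. \<exists>g\<in>S. (SUP \<theta>\<in>P. norm (g \<theta> - f \<theta>)) < r)"
      using f by (simp add: mdist_cont_space[OF assms(1,2) restrict_M[OF S] f] dist_norm)
    also have "\<dots> \<longleftrightarrow> f \<in> uniform_closure P S"
      using f M by (intro SUP_approx_iff_uniform_closure[OF assms(1,2)] bdd[OF S]) auto
    finally show ?thesis .
  qed
  have "?cl \<subseteq> ?M"
    by (metis closure_of_subset_topspace topspace_mtopology_of)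
  then have "?cl = ?M \<longleftrightarrow> ?M \<subseteq> uniform_closure P S"
    using cl by blast
  also have "\<dots> \<longleftrightarrow> {f. continuous_on P f} \<subseteq> uniform_closure P S"
  proof
    assume L: "?M \<subseteq> uniform_closure P S"
    show "{f. continuous_on P f} \<subseteq> uniform_closure P S"
    proof
      fix f :: "'p \<Rightarrow> 'b" assume "f \<in> {f. continuous_on P f}"
      then have "restrict f P \<in> uniform_closure P S"
        using restrict_M L by auto
      then show "f \<in> uniform_closure P S"
        by (auto simp: uniform_closure_def)
    qed
  qed (auto simp: M)
  finally show ?thesis .
qed

section \<open>Matrix powers and the matrix exponential\<close>

text \<open>In finite dimension bilinear maps are bounded. This yields continuity of products and
  submultiplicativity of the norm up to a constant.\<close>

lemma bounded_bilinear_matrix_matrix_mult: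
  "bounded_bilinear (\<lambda>(M :: real^'n^'l) (N :: real^'k^'n). M ** N)"
proof -
  have "(M + M') ** N = M ** N + M' ** N" for M M' :: "real^'n^'l" and N :: "real^'k^'n"
    by (simp add: vec_eq_iff matrix_matrix_mult_def distrib_right sum.distrib)
  moreover have "(c *\<^sub>R M) ** N = c *\<^sub>R (M ** N)" "M ** (c *\<^sub>R N) = c *\<^sub>R (M ** N)"
    for c and M :: "real^'n^'l" and N :: "real^'k^'n"
    by (simp_all add: matrix_scalar_ac scalar_matrix_assoc)
  ultimately have "bilinear (\<lambda>(M :: real^'n^'l) (N :: real^'k^'n). M ** N)"
    unfolding bilinear_def linear_iff by (simp add: matrix_add_ldistrib)
  then show ?thesis
    by (simp add: bilinear_conv_bounded_bilinear)
qed

lemma bounded_bilinear_matrix_vector_mult: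
  "bounded_bilinear (\<lambda>(M :: real^'n^'l) x. M *v x)"
proof -
  have "bilinear (\<lambda>(M :: real^'n^'l) x. M *v x)"
    unfolding bilinear_def linear_iff
    by (simp add: matrix_vector_right_distrib matrix_vector_mult_add_rdistrib
        matrix_vector_mult_scaleR flip: scaleR_matrix_vector_assoc)
  then show ?thesis
    by (simp add: bilinear_conv_bounded_bilinear)
qed

lemmas continuous_on_matrix_matrix_mult =
  bounded_bilinear.continuous_on[OF bounded_bilinear_matrix_matrix_mult]

lemmas continuous_on_matrix_vector_mult =
  bounded_bilinear.continuous_on[OF bounded_bilinear_matrix_vector_mult]

lemma mat_pow_scaleR: "mat_pow (c *\<^sub>R M) k = c ^ k *\<^sub>R mat_pow M k"
  by (induction k) (simp_all add: matrix_scalar_ac mult.commute flip: scalar_matrix_assoc)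

text \<open>Polynomials of different degrees can thus be summed over a common index range.\<close>

lemma mat_poly_eq_sum:
  assumes "degree p \<le> N"
  shows "mat_poly p M = (\<Sum>i\<le>N. coeff p i *\<^sub>R mat_pow M i)"
  unfolding mat_poly_def using assms
  by (intro sum.mono_neutral_left) (auto simp: coeff_eq_0)

text \<open>Each further factor costs at most \<open>a * K\<close>, where \<open>a\<close> bounds
  \<open>A\<close> on \<open>P\<close> and \<open>K\<close> is the constant of the product;
  \<open>D\<close> is the norm of the identity, the value at \<open>k = 0\<close>.\<close>

lemma norm_mat_pow_le:
  fixes A :: "'p \<Rightarrow> real^'n^'n"
  assumes "bounded (A ` P)"
  obtains D L where "D \<ge> 0" "L \<ge> 0" "\<And>\<theta> k. \<theta> \<in> P \<Longrightarrow> norm (mat_pow (A \<theta>) k) \<le> D * L ^ k"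
proof -
  obtain K where K: "K \<ge> 0" "\<And>(M :: real^'n^'n) (N :: real^'n^'n). norm (M ** N) \<le> norm M * norm N * K"
    using bounded_bilinear.nonneg_bounded[OF bounded_bilinear_matrix_matrix_mult] by blast
  obtain a where a: "a > 0" "\<And>\<theta>. \<theta> \<in> P \<Longrightarrow> norm (A \<theta>) \<le> a"
    using assms by (auto simp: bounded_pos)
  have "norm (mat_pow (A \<theta>) k) \<le> norm (mat 1 :: real^'n^'n) * (a * K) ^ k"
    if "\<theta> \<in> P" for \<theta> k
  proof (induction k)
    case (Suc k)
    have "norm (mat_pow (A \<theta>) (Suc k)) \<le> norm (A \<theta>) * norm (mat_pow (A \<theta>) k) * K"
      using K(2) by simp
    also have "\<dots> \<le> a * (norm (mat 1 :: real^'n^'n) * (a * K) ^ k) * K"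
      using Suc a that K(1) by (intro mult_right_mono mult_mono) auto
    finally show ?case by (simp add: mult_ac)
  qed simp
  then show ?thesis
    using that[of "norm (mat 1 :: real^'n^'n)" "a * K"] a K by auto
qed

lemma summable_const_power_over_fact: "summable (\<lambda>k. D * x ^ k / fact k :: real)"
  using summable_mult[OF summable_exp, of D x] by (simp add: field_simps)

lemma mat_exp_vec_sums:
  fixes M :: "real^'n^'n"
  shows "(\<lambda>k. (c ^ k / fact k) *\<^sub>R (mat_pow M k *v x)) sums (mat_exp (c *\<^sub>R M) *v x)"
proof -
  obtain D L where DL: "\<And>k. norm (mat_pow (c *\<^sub>R M) k) \<le> D * L ^ k"
    \<comment> \<open>A constant family over a one-point index set gives the bound for a single
      matrix.\<close>
    by (rule norm_mat_pow_le[of "\<lambda>_::unit. c *\<^sub>R M" UNIV]) auto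
  have "summable (\<lambda>k. (1 / fact k) *\<^sub>R mat_pow (c *\<^sub>R M) k)"
    by (rule summable_comparison_test'[OF summable_const_power_over_fact[of D L]])
       (simp add: DL divide_right_mono)
  then have "(\<lambda>k. (1 / fact k) *\<^sub>R mat_pow (c *\<^sub>R M) k) sums mat_exp (c *\<^sub>R M)"
    unfolding mat_exp_def by (rule summable_sums)
  from bounded_linear.sums[OF bounded_bilinear.bounded_linear_left[OF bounded_bilinear_matrix_vector_mult] this, of x]
  show ?thesis
    by (simp add: mat_pow_scaleR flip: scaleR_matrix_vector_assoc)
qed

text \<open>The source of all later majorants: growth in \<open>k\<close> is geometric uniformly on
  \<open>P\<close>, so division by \<open>fact k\<close> makes it summable.\<close>

lemma compact_mat_pow_bound:
  fixes A :: "'p::topological_space \<Rightarrow> real^'n^'n" and B :: "'p \<Rightarrow> real^'m^'n"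
  assumes "compact P" "continuous_on P A" "continuous_on P B"
  obtains D L where "D \<ge> 0" "L \<ge> 0"
    "\<And>\<theta> k w. \<theta> \<in> P \<Longrightarrow> norm (mat_pow (A \<theta>) k *v (B \<theta> *v w)) \<le> D * L ^ k * norm w"
proof -
  have bdd: "bounded (A ` P)" "bounded (B ` P)"
    using assms compact_continuous_image compact_imp_bounded by blast+
  obtain D L where DL: "D \<ge> 0" "L \<ge> 0"
    "\<And>\<theta> k. \<theta> \<in> P \<Longrightarrow> norm (mat_pow (A \<theta>) k) \<le> D * L ^ k"
    using norm_mat_pow_le[OF bdd(1)] by metis
  obtain K where K: "K \<ge> 0" "\<And>(M :: real^'n^'n) x. norm (M *v x) \<le> norm M * norm x * K"
    using bounded_bilinear.nonneg_bounded[OF bounded_bilinear_matrix_vector_mult] by blast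
  obtain K' where K': "K' \<ge> 0" "\<And>(M :: real^'m^'n) x. norm (M *v x) \<le> norm M * norm x * K'"
    using bounded_bilinear.nonneg_bounded[OF bounded_bilinear_matrix_vector_mult] by blast
  obtain b where b: "b > 0" "\<And>\<theta>. \<theta> \<in> P \<Longrightarrow> norm (B \<theta>) \<le> b"
    using bdd(2) by (auto simp: bounded_pos)
  have "norm (mat_pow (A \<theta>) k *v (B \<theta> *v w)) \<le> (D * b * K * K') * L ^ k * norm w"
    if "\<theta> \<in> P" for \<theta> k w
  proof -
    have "norm (B \<theta> *v w) \<le> b * norm w * K'"
      using K'(2)[of "B \<theta>" w] b(2)[OF that] K'(1)
      by (meson mult_right_mono norm_ge_zero order_trans)
    then have "norm (mat_pow (A \<theta>) k) * norm (B \<theta> *v w) * K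
        \<le> (D * L ^ k) * (b * norm w * K') * K"
      using DL that K by (intro mult_right_mono mult_mono) auto
    with K(2) show ?thesis
      by (smt (verit, best) mult.assoc mult.commute)
  qed
  then show ?thesis
    using that[of "D * b * K * K'" L] DL K K' b by auto
qed

section \<open>The discrete-time system\<close>

abbreviation krylov_span :: "('p \<Rightarrow> real^'n^'n) \<Rightarrow> ('p \<Rightarrow> real^'m^'n) \<Rightarrow> ('p \<Rightarrow> real^'n) set" where
  "krylov_span A B \<equiv> span {\<lambda>\<theta>. mat_pow (A \<theta>) k *v column j (B \<theta>) | k j. True}"

text \<open>The approximants of assertion (c). They link the span to the discrete-time states,
  because an input sequence can be read off from their coefficients.\<close>

definition poly_state ::
  "('p \<Rightarrow> real^'n^'n) \<Rightarrow> ('p \<Rightarrow> real^'m^'n) \<Rightarrow> ('m \<Rightarrow> real poly) \<Rightarrow> 'p \<Rightarrow> real^'n" where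
  "poly_state A B p \<theta> = (\<Sum>j\<in>UNIV. mat_poly (p j) (A \<theta>) *v column j (B \<theta>))"

lemma matrix_vector_mult_columns:
  fixes M :: "real^'m^'n"
  shows "M *v w = (\<Sum>j\<in>UNIV. w $ j *\<^sub>R column j M)"
  by (simp add: matrix_mult_sum scalar_mult_eq_scaleR)

lemma mat_pow_vec_in_krylov_span: "(\<lambda>\<theta>. mat_pow (A \<theta>) k *v (B \<theta> *v w)) \<in> krylov_span A B"
proof -
  have "(\<lambda>\<theta>. mat_pow (A \<theta>) k *v (B \<theta> *v w))
      = (\<Sum>j\<in>UNIV. w $ j *\<^sub>R (\<lambda>\<theta>. mat_pow (A \<theta>) k *v column j (B \<theta>)))"
    by (simp add: matrix_vector_mult_columns[of "B _"] matrix_vector_mult_scaleR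
        linear_sum[OF matrix_vector_mul_linear] scaleR_fun_def sum_fun_eq[symmetric])
  also have "\<dots> \<in> krylov_span A B"
    by (intro span_sum span_scale span_base) blast
  finally show ?thesis .
qed

lemma dt_state_in_krylov_span: "dt_state A B T u \<in> krylov_span A B"
proof -
  have "dt_state A B T u = (\<Sum>k<T. (\<lambda>\<theta>. mat_pow (A \<theta>) k *v (B \<theta> *v u (T - 1 - k))))"
    by (simp add: fun_eq_iff dt_state_def sum_fun_eq[symmetric])
  then show ?thesis
    by (simp only: span_sum[OF mat_pow_vec_in_krylov_span])
qed

lemma mat_poly_add: "mat_poly (p + q) M = mat_poly p M + mat_poly q M"
proof -
  have "degree (p + q) \<le> max (degree p) (degree q)"
    by (rule degree_add_le_max)
  then show ?thesis
    by (simp add: mat_poly_eq_sum[of _ "max (degree p) (degree q)"] scaleR_add_left sum.distrib)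
qed

lemma mat_poly_smult: "mat_poly (smult c p) M = c *\<^sub>R mat_poly p M"
  by (simp add: mat_poly_eq_sum[of _ "degree p"] degree_smult_le scaleR_sum_right)

lemma mat_poly_0: "mat_poly 0 M = 0"
  by (simp add: mat_poly_def)

lemma mat_poly_monom: "mat_poly (monom 1 k) M = mat_pow M k"
  by (simp add: mat_poly_eq_sum[of _ k] degree_monom_le if_distrib[of "\<lambda>c. c *\<^sub>R _"] cong: if_cong)

text \<open>Polynomials add and scale columnwise, so these functions form a subspace; a generator
  arises from the monomial of degree \<open>k\<close> in slot \<open>j\<close> and zero in all other
  slots.\<close>

lemma krylov_span_subset_poly_state: "krylov_span A B \<subseteq> range (poly_state A B)"
proof (rule span_minimal)
  show "subspace (range (poly_state A B))"
    unfolding subspace_def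
  proof (intro conjI ballI allI)
    have "0 = poly_state A B (\<lambda>_. 0)"
      by (simp add: fun_eq_iff poly_state_def mat_poly_0)
    then show "0 \<in> range (poly_state A B)"
      by blast
  next
    fix f g assume "f \<in> range (poly_state A B)" "g \<in> range (poly_state A B)"
    then obtain p q where "f = poly_state A B p" "g = poly_state A B q"
      by blast
    then have "f + g = poly_state A B (\<lambda>j. p j + q j)"
      by (simp add: fun_eq_iff poly_state_def mat_poly_add matrix_vector_mult_add_rdistrib
          sum.distrib)
    then show "f + g \<in> range (poly_state A B)"
      by blast
  next
    fix c :: real and f assume "f \<in> range (poly_state A B)"
    then obtain p where "f = poly_state A B p"
      by blast
    then have "c *\<^sub>R f = poly_state A B (\<lambda>j. smult c (p j))"
      by (simp add: fun_eq_iff poly_state_def mat_poly_smult scaleR_fun_def scaleR_sum_right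
          scaleR_matrix_vector_assoc)
    then show "c *\<^sub>R f \<in> range (poly_state A B)"
      by blast
  qed
next
  have "(\<lambda>\<theta>. mat_pow (A \<theta>) k *v column j (B \<theta>)) = poly_state A B ((\<lambda>_. 0)(j := monom 1 k))" for k j
  proof
    fix \<theta>
    have "poly_state A B ((\<lambda>_. 0)(j := monom 1 k)) \<theta>
        = (\<Sum>i\<in>UNIV. if i = j then mat_pow (A \<theta>) k *v column j (B \<theta>) else 0)"
      unfolding poly_state_def by (intro sum.cong) (auto simp: mat_poly_0 mat_poly_monom)
    then show "mat_pow (A \<theta>) k *v column j (B \<theta>) = poly_state A B ((\<lambda>_. 0)(j := monom 1 k)) \<theta>"
      by simp
  qed
  then show "{\<lambda>\<theta>. mat_pow (A \<theta>) k *v column j (B \<theta>) | k j. True} \<subseteq> range (poly_state A B)"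
    by blast
qed

lemma poly_state_eq_dt_state:
  fixes A :: "'p \<Rightarrow> real^'n^'n" and B :: "'p \<Rightarrow> real^'m^'n"
  shows "\<exists>T>0. \<exists>u. poly_state A B p = dt_state A B T u"
proof -
  define N where "N = Max (range (\<lambda>j. degree (p j)))"
  have N: "degree (p j) \<le> N" for j
    unfolding N_def by (rule Max_ge) auto
  \<comment> \<open>An input applied at time \<open>i\<close> is propagated \<open>N - i\<close>
    times by the horizon \<open>Suc N\<close>, so it must carry the coefficients of that degree. The
    horizon is positive even for constant polynomials.\<close>
  define u :: "nat \<Rightarrow> real^'m" where "u = (\<lambda>i. \<chi> j. coeff (p j) (N - i))"
  have "poly_state A B p \<theta> = dt_state A B (Suc N) u \<theta>" for \<theta>
  proof -
    have "poly_state A B p \<theta>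
        = (\<Sum>j\<in>UNIV. \<Sum>k\<le>N. coeff (p j) k *\<^sub>R (mat_pow (A \<theta>) k *v column j (B \<theta>)))"
      by (simp add: poly_state_def mat_poly_eq_sum[OF N] scaleR_matrix_vector_assoc
          bounded_bilinear.sum_left[OF bounded_bilinear_matrix_vector_mult])
    also have "\<dots> = (\<Sum>k\<le>N. \<Sum>j\<in>UNIV. coeff (p j) k *\<^sub>R (mat_pow (A \<theta>) k *v column j (B \<theta>)))"
      by (rule sum.swap)
    also have "\<dots> = (\<Sum>k\<le>N. mat_pow (A \<theta>) k *v (B \<theta> *v u (N - k)))"
      by (intro sum.cong) (simp_all add: u_def matrix_vector_mult_columns[of "B \<theta>"]
          bounded_bilinear.sum_right[OF bounded_bilinear_matrix_vector_mult] matrix_vector_mult_scaleR)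
    also have "\<dots> = dt_state A B (Suc N) u \<theta>"
      by (simp add: dt_state_def lessThan_Suc_atMost)
    finally show ?thesis .
  qed
  then show ?thesis
    by blast
qed

text \<open>Closes the cycle of inclusions: span elements are polynomial states, these are
  discrete-time states, and those lie in the span.\<close>

lemma range_poly_state_eq: "range (poly_state A B) = krylov_span A B"
proof (intro antisym krylov_span_subset_poly_state image_subsetI)
  show "poly_state A B p \<in> krylov_span A B" for p
    using poly_state_eq_dt_state[of A B p] dt_state_in_krylov_span[of A B] by auto
qed

lemma dt_states_eq: "{dt_state A B T u | T u. T > 0} = krylov_span A B"
proof (intro antisym subsetI)
  fix f assume "f \<in> krylov_span A B"
  then obtain p where "f = poly_state A B p"
    using range_poly_state_eq by blast
  then show "f \<in> {dt_state A B T u | T u. T > 0}"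
    using poly_state_eq_dt_state[of A B p] by auto
next
  fix f assume "f \<in> {dt_state A B T u | T u. T > 0}"
  then obtain T u where "f = dt_state A B T u"
    by blast
  then show "f \<in> krylov_span A B"
    by (simp only: dt_state_in_krylov_span)
qed

lemma continuous_on_krylov_span:
  assumes "continuous_on P A" "continuous_on P B" "f \<in> krylov_span A B"
  shows "continuous_on P f"
proof -
  obtain p where f: "f = poly_state A B p"
    using assms(3) range_poly_state_eq by blast
  have pow: "continuous_on P (\<lambda>\<theta>. mat_pow (A \<theta>) k)" for k
    by (induction k) (auto intro!: continuous_on_matrix_matrix_mult assms(1))
  have col: "continuous_on P (\<lambda>\<theta>. column j (B \<theta>))" for j
    unfolding column_def by (intro continuous_intros assms(2))
  show ?thesis
    unfolding f poly_state_def mat_poly_def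
    by (intro continuous_intros continuous_on_matrix_vector_mult pow col)
qed

section \<open>The continuous-time system\<close>

text \<open>The weight is the coefficient of \<open>A ^ k\<close> in the exponential of
  \<open>(T - s) A\<close>, so these are the vectors to which the \<open>A ^ k B\<close> are applied
  in the expansion of the state.\<close>

definition ct_moment :: "real \<Rightarrow> (real \<Rightarrow> real^'m) \<Rightarrow> nat \<Rightarrow> real^'m" where
  "ct_moment T u k = (LINT s:{0..T}|lebesgue. ((T - s) ^ k / fact k) *\<^sub>R u s)"

lemma set_integrable_power_scaleR:
  fixes u :: "real \<Rightarrow> real^'m"
  assumes "u absolutely_integrable_on {0..T}"
  shows "set_integrable lebesgue {0..T} (\<lambda>s. ((T - s) ^ k / fact k) *\<^sub>R u s)"
proof (rule absolutely_integrable_bounded_measurable_product[where h = scaleR])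
  have c: "continuous_on {0..T} (\<lambda>s. (T - s) ^ k / fact k :: real)"
    by (intro continuous_intros) auto
  then show "(\<lambda>s. (T - s) ^ k / fact k :: real) \<in> borel_measurable (lebesgue_on {0..T})"
    by (intro continuous_imp_measurable_on_sets_lebesgue) auto
  show "bounded ((\<lambda>s. (T - s) ^ k / fact k :: real) ` {0..T})"
    using c compact_continuous_image compact_imp_bounded compact_Icc by blast
  show "bilinear (scaleR :: real \<Rightarrow> real^'m \<Rightarrow> real^'m)"
    by (simp add: bilinear_conv_bounded_bilinear bounded_bilinear_scaleR)
qed (use assms in auto)

text \<open>Used twice: with \<open>v\<close> the image of the input value under
  \<open>A ^ k B\<close>, and with \<open>v = w\<close> and \<open>D = L = 1\<close> to bound the
  moments.\<close>

lemma norm_ct_integrand_le: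
  assumes "0 \<le> s" "s \<le> T" "norm v \<le> D * L ^ k * norm w" "D \<ge> 0" "L \<ge> 0"
  shows "norm (((T - s) ^ k / fact k) *\<^sub>R v) \<le> D * (L * T) ^ k / fact k * norm w"
proof -
  have "(T - s) ^ k * norm v \<le> T ^ k * (D * L ^ k * norm w)"
    using assms by (intro mult_mono power_mono) auto
  then show ?thesis
    using assms by (simp add: divide_right_mono power_mult_distrib mult_ac)
qed

text \<open>The exponential series is integrated term by term. The \<open>k\<close>-th term is
  bounded by \<open>D * (L * T) ^ k / fact k\<close> times the norm of the input, summable in
  \<open>k\<close> and integrable in \<open>s\<close>; the linear map \<open>G k\<close> is then
  pulled out of the integral.\<close>

lemma ct_state_sums:
  fixes A :: "'p \<Rightarrow> real^'n^'n" and B :: "'p \<Rightarrow> real^'m^'n"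
  assumes u: "u absolutely_integrable_on {0..T}"
  shows "(\<lambda>k. mat_pow (A \<theta>) k *v (B \<theta> *v ct_moment T u k)) sums ct_state A B T u \<theta>"
proof -
  define G where "G k w = mat_pow (A \<theta>) k *v (B \<theta> *v w)" for k and w :: "real^'m"
  have G: "bounded_linear (G k)" for k
    unfolding G_def
    by (intro bounded_linear_compose[OF matrix_vector_mul_bounded_linear]
        matrix_vector_mul_bounded_linear)
  obtain D L where DL: "D \<ge> 0" "L \<ge> 0" "\<And>k w. norm (G k w) \<le> D * L ^ k * norm w"
    \<comment> \<open>Here \<theta> is fixed, so the bound is taken for constant families over a
      singleton.\<close>
    unfolding G_def by (rule compact_mat_pow_bound[of "{0::real}" "\<lambda>_. A \<theta>" "\<lambda>_. B \<theta>"]) auto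
  define f where "f k s = indicator {0..T} s *\<^sub>R G k (((T - s) ^ k / fact k) *\<^sub>R u s)" for k s
  have f_alt: "f k s = G k (indicator {0..T} s *\<^sub>R (((T - s) ^ k / fact k) *\<^sub>R u s))" for k s
    unfolding f_def by (simp add: linear_scale[OF bounded_linear.linear[OF G]])
  have int_u: "integrable lebesgue (\<lambda>s. indicator {0..T} s *\<^sub>R (((T - s) ^ k / fact k) *\<^sub>R u s))" for k
    using set_integrable_power_scaleR[OF u] unfolding set_integrable_def .
  have int_f: "integrable lebesgue (f k)" for k
    unfolding f_alt by (rule integrable_bounded_linear[OF G int_u])
  have f_sums: "(\<lambda>k. f k s) sums
      (indicator {0..T} s *\<^sub>R (mat_exp ((T - s) *\<^sub>R A \<theta>) *v (B \<theta> *v u s)))" for s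
    unfolding f_def G_def
    using sums_scaleR_right[OF mat_exp_vec_sums[of "T - s" "A \<theta>" "B \<theta> *v u s"]]
    by (simp add: matrix_vector_mult_scaleR)
  have int_norm_u: "integrable lebesgue (\<lambda>s. norm (indicator {0..T} s *\<^sub>R u s))"
    using u unfolding set_integrable_def by (rule integrable_norm)
  have norm_f: "norm (f k s) \<le> D * (L * T) ^ k / fact k * norm (indicator {0..T} s *\<^sub>R u s)" for k s
    using norm_ct_integrand_le[OF _ _ DL(3) DL(1,2), of s T k "u s"]
    by (auto simp: f_def linear_scale[OF bounded_linear.linear[OF G]] indicator_def)
  have "(\<lambda>k. integral\<^sup>L lebesgue (f k)) sums (\<integral>s. (\<Sum>k. f k s) \<partial>lebesgue)"
  proof (rule sums_integral[OF int_f])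
    have "summable (\<lambda>k. norm (f k s))" for s
      by (rule summable_comparison_test'[OF summable_mult2[OF summable_const_power_over_fact]])
         (simp only: real_norm_def abs_norm_cancel, rule norm_f)
    then show "AE s in lebesgue. summable (\<lambda>k. norm (f k s))"
      by simp
    have "(\<integral>s. norm (f k s) \<partial>lebesgue)
        \<le> D * (L * T) ^ k / fact k * (\<integral>s. norm (indicator {0..T} s *\<^sub>R u s) \<partial>lebesgue)" for k
      unfolding Bochner_Integration.integral_mult_right_zero[symmetric]
      by (intro integral_mono integrable_norm int_f integrable_mult_right int_norm_u norm_f)
    then show "summable (\<lambda>k. \<integral>s. norm (f k s) \<partial>lebesgue)"
      by (intro summable_comparison_test'[OF summable_mult2[OF summable_const_power_over_fact]])
         (simp add: integral_nonneg)
  qed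
  moreover have "integral\<^sup>L lebesgue (f k) = G k (ct_moment T u k)" for k
    unfolding f_alt ct_moment_def set_lebesgue_integral_def
    by (rule integral_bounded_linear[OF G int_u])
  moreover have "(\<integral>s. (\<Sum>k. f k s) \<partial>lebesgue) = ct_state A B T u \<theta>"
    unfolding ct_state_def set_lebesgue_integral_def
    by (simp add: sums_unique[OF f_sums, symmetric])
  ultimately show ?thesis
    by (simp add: G_def)
qed

lemma norm_ct_moment_le:
  assumes u: "u absolutely_integrable_on {0..T}"
  shows "norm (ct_moment T u k) \<le> T ^ k / fact k * (LINT s:{0..T}|lebesgue. norm (u s))"
proof -
  have "norm (indicator {0..T} s *\<^sub>R (((T - s) ^ k / fact k) *\<^sub>R u s))
      \<le> T ^ k / fact k * (indicator {0..T} s *\<^sub>R norm (u s))" for s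
    using norm_ct_integrand_le[of s T "u s" 1 1 k "u s"] by (auto simp: indicator_def)
  moreover have "integrable lebesgue (\<lambda>s. indicator {0..T} s *\<^sub>R norm (u s))"
    using set_integrable_norm[OF u] unfolding set_integrable_def .
  ultimately have "norm (ct_moment T u k)
      \<le> (\<integral>s. T ^ k / fact k * (indicator {0..T} s *\<^sub>R norm (u s)) \<partial>lebesgue)"
    unfolding ct_moment_def set_lebesgue_integral_def
    by (intro order_trans[OF integral_norm_bound integral_mono] integrable_norm integrable_mult_right
        set_integrable_power_scaleR[OF u, unfolded set_integrable_def])
  then show ?thesis
    by (simp only: set_lebesgue_integral_def Bochner_Integration.integral_mult_right_zero)
qed

text \<open>The partial sums of the expansion lie in the span, and the moment bound turns the
  majorant into an exponential series times the L1 norm \<open>U\<close> of the input, independent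
  of \<theta>.\<close>

lemma ct_state_in_uniform_closure:
  fixes A :: "'p::topological_space \<Rightarrow> real^'n^'n" and B :: "'p \<Rightarrow> real^'m^'n"
  assumes P: "compact P" "continuous_on P A" "continuous_on P B"
    and T: "T > 0" and u: "u absolutely_integrable_on {0..T}"
  shows "ct_state A B T u \<in> uniform_closure P (krylov_span A B)"
proof -
  obtain D L where DL: "D \<ge> 0" "L \<ge> 0"
    "\<And>\<theta> k w. \<theta> \<in> P \<Longrightarrow> norm (mat_pow (A \<theta>) k *v (B \<theta> *v w)) \<le> D * L ^ k * norm w"
    using compact_mat_pow_bound[OF P] by metis
  define U where "U = (LINT s:{0..T}|lebesgue. norm (u s))"
  show ?thesis
  proof (rule uniform_closure_suminf)
    show "norm (mat_pow (A \<theta>) k *v (B \<theta> *v ct_moment T u k)) \<le> D * (L * T) ^ k / fact k * U"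
      if "\<theta> \<in> P" for \<theta> k
    proof -
      have "D * L ^ k * norm (ct_moment T u k) \<le> D * L ^ k * (T ^ k / fact k * U)"
        unfolding U_def using DL by (intro mult_left_mono norm_ct_moment_le[OF u]) auto
      with DL(3)[OF that, of k "ct_moment T u k"] show ?thesis
        by (simp add: power_mult_distrib mult_ac)
    qed
    show "summable (\<lambda>k. D * (L * T) ^ k / fact k * U)"
      by (rule summable_mult2[OF summable_const_power_over_fact])
    show "ct_state A B T u \<theta> = (\<Sum>k. mat_pow (A \<theta>) k *v (B \<theta> *v ct_moment T u k))" for \<theta>
      by (rule sums_unique[OF ct_state_sums[OF u]])
  qed (rule subspace_span mat_pow_vec_in_krylov_span)+
qed

section \<open>Recovering the span from continuous-time states\<close>

lemma subspace_ct_states: "subspace {ct_state A B T u | u. u absolutely_integrable_on {0..T}}"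
  unfolding subspace_def
proof (intro conjI ballI allI)
  have "ct_state A B T (\<lambda>_. 0) = 0"
    by (simp add: fun_eq_iff ct_state_def set_lebesgue_integral_def)
  then show "0 \<in> {ct_state A B T u | u. u absolutely_integrable_on {0..T}}"
    by (intro CollectI exI[of _ "\<lambda>_. 0"]) (simp add: set_integrable_def)
next
  fix f g assume "f \<in> {ct_state A B T u | u. u absolutely_integrable_on {0..T}}"
    "g \<in> {ct_state A B T u | u. u absolutely_integrable_on {0..T}}"
  then obtain u v where u: "u absolutely_integrable_on {0..T}" "f = ct_state A B T u"
    and v: "v absolutely_integrable_on {0..T}" "g = ct_state A B T v"
    by blast
  have uv: "(\<lambda>s. u s + v s) absolutely_integrable_on {0..T}"
    using u v by (intro set_integral_add)
  \<comment> \<open>Additivity of integrals requires integrable summands, which is available for the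
    moments. It passes to the states by uniqueness of the sum of the expansion.\<close>
  have moment: "ct_moment T (\<lambda>s. u s + v s) k = ct_moment T u k + ct_moment T v k" for k
    unfolding ct_moment_def
    using set_integral_add(2)[OF set_integrable_power_scaleR[OF u(1)] set_integrable_power_scaleR[OF v(1)]]
    by (simp add: scaleR_add_right)
  have "(\<lambda>k. mat_pow (A \<theta>) k *v (B \<theta> *v (ct_moment T u k + ct_moment T v k))) sums
      (ct_state A B T u \<theta> + ct_state A B T v \<theta>)" for \<theta>
    using sums_add[OF ct_state_sums[OF u(1), of A \<theta> B] ct_state_sums[OF v(1), of A \<theta> B]]
    by (simp add: matrix_vector_right_distrib)
  then have "ct_state A B T u \<theta> + ct_state A B T v \<theta> = ct_state A B T (\<lambda>s. u s + v s) \<theta>" for \<theta>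
    by (rule sums_unique2[OF _ ct_state_sums[OF uv, of A \<theta> B, unfolded moment]])
  then have "f + g = ct_state A B T (\<lambda>s. u s + v s)"
    by (simp add: u(2) v(2) fun_eq_iff)
  then show "f + g \<in> {ct_state A B T u | u. u absolutely_integrable_on {0..T}}"
    using uv by blast
next
  fix c :: real and f assume "f \<in> {ct_state A B T u | u. u absolutely_integrable_on {0..T}}"
  then obtain u where u: "u absolutely_integrable_on {0..T}" "f = ct_state A B T u"
    by blast
  have "c *\<^sub>R f = ct_state A B T (\<lambda>s. c *\<^sub>R u s)"
    unfolding u(2) ct_state_def scaleR_fun_def
    by (simp add: matrix_vector_mult_scaleR)
  then show "c *\<^sub>R f \<in> {ct_state A B T u | u. u absolutely_integrable_on {0..T}}"
    using u(1) by (auto intro!: exI[of _ "\<lambda>s. c *\<^sub>R u s"])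
qed

text \<open>The weight \<open>(T - s) ^ k / fact k\<close> has the antiderivative
  \<open>- ((T - s) ^ Suc k / fact (Suc k))\<close>, which vanishes at the final time. A step ending
  there therefore has a multiple of a pure power of its length \<open>t\<close> as moment.\<close>

lemma ct_moment_late_step:
  fixes v :: "real^'m"
  assumes "0 < t" "t \<le> T"
  shows "(\<lambda>s. if s \<in> {T-t..T} then v else 0) absolutely_integrable_on {0..T}"
    and "ct_moment T (\<lambda>s. if s \<in> {T-t..T} then v else 0) k = (t ^ Suc k / fact (Suc k)) *\<^sub>R v"
proof -
  show ai: "(\<lambda>s. if s \<in> {T-t..T} then v else 0) absolutely_integrable_on {0..T}"
  proof -
    have "indicator {0..T} s *\<^sub>R (if s \<in> {T-t..T} then v else 0) = indicator {T-t..T} s *\<^sub>R v" for s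
      using assms by (auto simp: indicator_def)
    then show ?thesis
      using absolutely_integrable_continuous_real[of "T-t" T "\<lambda>_. v"]
      by (simp only: set_integrable_def continuous_on_const simp_thms)
  qed
  have "((\<lambda>s. - ((T - s) ^ Suc k / fact (Suc k))) has_real_derivative (T - s) ^ k / fact k)
      (at s within {T-t..T})" for s
  proof -
    have "((\<lambda>s. T - s) has_real_derivative -1) (at s within {T-t..T})"
      by (auto intro!: derivative_eq_intros)
    then have "((\<lambda>s. - ((T - s) ^ Suc k / fact (Suc k))) has_real_derivative
        - ((1 + real k) * (-1 * (T - s) ^ k) / fact (Suc k))) (at s within {T-t..T})"
      by (intro DERIV_minus DERIV_cdivide DERIV_power_Suc)
    moreover have "1 + real k \<noteq> 0"
      by linarith
    then have "- ((1 + real k) * (-1 * (T - s) ^ k) / fact (Suc k)) = (T - s) ^ k / fact k"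
      by (simp add: fact_Suc)
    ultimately show ?thesis
      by (simp only:)
  qed
  then have "((\<lambda>s. (T - s) ^ k / fact k) has_integral
      - ((T - T) ^ Suc k / fact (Suc k)) - - ((T - (T - t)) ^ Suc k / fact (Suc k))) {T-t..T}"
    using assms by (intro fundamental_theorem_of_calculus)
      (auto simp flip: has_real_derivative_iff_has_vector_derivative)
  then have "((\<lambda>s. (T - s) ^ k / fact k) has_integral (t ^ Suc k / fact (Suc k))) {T-t..T}"
    by simp
  then have "((\<lambda>s. ((T - s) ^ k / fact k) *\<^sub>R v) has_integral ((t ^ Suc k / fact (Suc k)) *\<^sub>R v)) {T-t..T}"
    by (rule has_integral_scaleR_left)
  then have "((\<lambda>s. if s \<in> {T-t..T} then ((T - s) ^ k / fact k) *\<^sub>R v else 0) has_integral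
      ((t ^ Suc k / fact (Suc k)) *\<^sub>R v)) {0..T}"
    using assms by (subst has_integral_restrict) auto
  moreover have "(\<lambda>s. ((T - s) ^ k / fact k) *\<^sub>R (if s \<in> {T-t..T} then v else 0))
      = (\<lambda>s. if s \<in> {T-t..T} then ((T - s) ^ k / fact k) *\<^sub>R v else 0)"
    by (simp add: fun_eq_iff)
  ultimately show "ct_moment T (\<lambda>s. if s \<in> {T-t..T} then v else 0) k = (t ^ Suc k / fact (Suc k)) *\<^sub>R v"
    unfolding ct_moment_def set_lebesgue_integral_eq_integral(2)[OF set_integrable_power_scaleR[OF ai]]
    by (simp only: integral_unique)
qed

lemma mat_pow_vec_in_closure_ct_states:
  fixes A :: "'p::topological_space \<Rightarrow> real^'n^'n" and B :: "'p \<Rightarrow> real^'m^'n"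
  assumes P: "compact P" "continuous_on P A" "continuous_on P B"
  shows "(\<lambda>\<theta>. mat_pow (A \<theta>) k *v (B \<theta> *v v))
    \<in> uniform_closure P {ct_state A B 1 u | u. u absolutely_integrable_on {0..1}}" (is "_ \<in> uniform_closure P ?S")
proof -
  obtain D L where DL: "D \<ge> 0" "L \<ge> 0"
    "\<And>\<theta> k w. \<theta> \<in> P \<Longrightarrow> norm (mat_pow (A \<theta>) k *v (B \<theta> *v w)) \<le> D * L ^ k * norm w"
    using compact_mat_pow_bound[OF P] by metis
  \<comment> \<open>The state reached by the late step has the terms
    \<open>t ^ Suc k *\<^sub>R c k\<close>. Dividing it by \<open>t\<close> gives a power series
    starting at degree 0, and the quotient is still reachable because the states at time 1 form a
    subspace.\<close>
  define c where "c k = (\<lambda>\<theta>. (1 / fact (Suc k)) *\<^sub>R (mat_pow (A \<theta>) k *v (B \<theta> *v v)))" for k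
  define u where "u t s = (if s \<in> {1-t..1} then v else 0)" for t s :: real
  have u: "u t absolutely_integrable_on {0..1}"
    "ct_moment 1 (u t) k = (t ^ Suc k / fact (Suc k)) *\<^sub>R v" if "0 < t" "t \<le> 1" for t k
    using ct_moment_late_step[OF that] by (simp_all add: u_def[abs_def])
  have "c k \<in> uniform_closure P ?S"
  proof (rule power_series_coeffs_in_uniform_closure[where F = "\<lambda>t. (1 / t) *\<^sub>R ct_state A B 1 (u t)"])
    show "subspace ?S"
      by (rule subspace_ct_states)
    show "norm (c k \<theta>) \<le> D * L ^ k / fact k * norm v" if "\<theta> \<in> P" for k \<theta>
    proof -
      have "norm (c k \<theta>) = norm (mat_pow (A \<theta>) k *v (B \<theta> *v v)) / fact (Suc k)"
        by (simp add: c_def)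
      also have "\<dots> \<le> (D * L ^ k * norm v) / fact k"
        using DL(3)[OF that, of k v] DL(1,2) by (intro frac_le fact_mono) auto
      finally show ?thesis
        by simp
    qed
    show "summable (\<lambda>k. D * L ^ k / fact k * norm v)"
      by (rule summable_mult2[OF summable_const_power_over_fact])
    show "(\<lambda>k. t ^ k *\<^sub>R c k \<theta>) sums ((1 / t) *\<^sub>R ct_state A B 1 (u t)) \<theta>"
      if "0 < t" "t \<le> 1" for t \<theta>
      using sums_scaleR_right[OF ct_state_sums[OF u(1)[OF that], of A \<theta> B], of "1/t"] that
      by (simp add: u(2)[OF that] matrix_vector_mult_scaleR c_def scaleR_fun_def field_simps)
    show "(1 / t) *\<^sub>R ct_state A B 1 (u t) \<in> ?S" if "0 < t" "t \<le> 1" for t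
      using u(1)[OF that] by (intro subspace_scale[OF subspace_ct_states]) blast
  qed
  then have "fact (Suc k) *\<^sub>R c k \<in> uniform_closure P ?S"
    by (rule subspace_scale[OF subspace_uniform_closure[OF subspace_ct_states]])
  then show ?thesis
    by (simp add: c_def scaleR_fun_def del: fact_Suc)
qed

text \<open>For the second inclusion, horizon 1 suffices: with the horizon fixed, inputs add
  pointwise, so the reachable states form a subspace and \<open>span_minimal\<close> applies to
  their closure.\<close>

lemma uniform_closure_ct_states:
  fixes A :: "'p::topological_space \<Rightarrow> real^'n^'n" and B :: "'p \<Rightarrow> real^'m^'n"
  assumes P: "compact P" "continuous_on P A" "continuous_on P B"
  shows "uniform_closure P {ct_state A B T u | T u. T > 0 \<and> u absolutely_integrable_on {0..T}}
    = uniform_closure P (krylov_span A B)" (is "uniform_closure P ?S = _")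
proof (rule antisym)
  show "uniform_closure P ?S \<subseteq> uniform_closure P (krylov_span A B)"
    using ct_state_in_uniform_closure[OF P] by (intro uniform_closure_minimal) blast
  let ?R = "{ct_state A B 1 u | u. u absolutely_integrable_on {0..1}}"
  have "(\<lambda>\<theta>. mat_pow (A \<theta>) k *v column j (B \<theta>)) \<in> uniform_closure P ?R" for k j
    \<comment> \<open>The \<open>j\<close>-th unit vector as input value selects column
      \<open>j\<close> of \<open>B\<close>.\<close>
    using mat_pow_vec_in_closure_ct_states[OF P, of k "axis j 1"]
    by (simp only: matrix_vector_mult_basis)
  then have "{\<lambda>\<theta>. mat_pow (A \<theta>) k *v column j (B \<theta>) | k j. True} \<subseteq> uniform_closure P ?R"
    by blast
  then have "krylov_span A B \<subseteq> uniform_closure P ?R"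
    by (rule span_minimal[OF _ subspace_uniform_closure[OF subspace_ct_states]])
  moreover have "?R \<subseteq> ?S"
    using zero_less_one by blast
  then have "uniform_closure P ?R \<subseteq> uniform_closure P ?S"
    using uniform_closure_superset by (intro uniform_closure_minimal) (rule order_trans)
  ultimately show "uniform_closure P (krylov_span A B) \<subseteq> uniform_closure P ?S"
    by (intro uniform_closure_minimal) (rule order_trans)
qed

section \<open>Reduction of all four assertions to one density statement\<close>

theorem theorem1:
  fixes P :: "(real^'d) set"
    and A :: "real^'d \<Rightarrow> real^'n^'n"
    and B :: "real^'d \<Rightarrow> real^'m^'n"
  assumes "P \<noteq> {}" and "compact P" and "closure (interior P) = P"
    and "continuous_on P A" and "continuous_on P B"
  defines "a \<equiv> ct_uniformly_ensemble_controllable P A B"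
    and "b \<equiv> dt_uniformly_ensemble_controllable P A B"
    and "c \<equiv> (\<forall>\<epsilon>>0. \<forall>xs :: real^'d \<Rightarrow> real^'n. continuous_on P xs \<longrightarrow>
           (\<exists>p :: 'm \<Rightarrow> real poly.
              (SUP \<theta>\<in>P. norm ((\<Sum>j\<in>UNIV. mat_poly (p j) (A \<theta>) *v column j (B \<theta>)) - xs \<theta>)) < \<epsilon>))"
    and "d \<equiv> mtopology_of (cont_space P) closure_of
             ((\<lambda>f. restrict f P) ` span {\<lambda>\<theta>. mat_pow (A \<theta>) k *v column j (B \<theta>) | k j. True})
           = mspace (cont_space P)"
  shows "(a \<longleftrightarrow> b) \<and> (b \<longleftrightarrow> c) \<and> (c \<longleftrightarrow> d)"
proof -
  note P = assms(1,2,4,5)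
  \<comment> \<open>Trades a quantifier over a set of states for quantifiers over horizon and input,
    as in the definitions of controllability.\<close>
  have bex_states: "(\<exists>f\<in>{h T u | T u. R T u}. Q f) \<longleftrightarrow> (\<exists>T u. R T u \<and> Q (h T u))"
    for h :: "'t \<Rightarrow> 'u \<Rightarrow> real^'d \<Rightarrow> real^'n" and R Q
    by blast
  let ?K = "krylov_span A B"
  let ?dense = "{xs. continuous_on P xs} \<subseteq> uniform_closure P ?K"
  have dense: "?dense \<longleftrightarrow> (\<forall>xs. continuous_on P xs \<longrightarrow> xs \<in> uniform_closure P ?K)"
    by (simp only: subset_iff mem_Collect_eq)
  \<comment> \<open>Assertion (c) quantifies over \<epsilon> before the target function, the others
    after it.\<close>
  have swap: "(\<forall>e>0. \<forall>xs. C xs \<longrightarrow> Q e xs) \<longleftrightarrow> (\<forall>xs. C xs \<longrightarrow> (\<forall>e>0. Q e xs))"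
    for C and Q :: "real \<Rightarrow> (real^'d \<Rightarrow> real^'n) \<Rightarrow> bool"
    by blast
  have bdd: "bounded (f ` P)" if "f \<in> ?K" for f
    using continuous_on_krylov_span[OF P(3,4) that] P(2)
      compact_continuous_image compact_imp_bounded by blast
  have sup: "(\<forall>e>0. \<exists>f\<in>?K. (SUP \<theta>\<in>P. norm (f \<theta> - xs \<theta>)) < e) \<longleftrightarrow> xs \<in> uniform_closure P ?K"
    if "continuous_on P xs" for xs
    by (rule SUP_approx_iff_uniform_closure[OF P(2,1) that bdd])
  let ?S = "{ct_state A B T u | T u. T > 0 \<and> u absolutely_integrable_on {0..T}}"
  have bdd_ct: "bounded (f ` P)" if "f \<in> ?S" for f
    using that ct_state_in_uniform_closure[OF P(2-4)] bounded_uniform_closure[OF _ bdd] by blast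
  have ct: "(\<forall>e>0. \<exists>f\<in>?S. (SUP \<theta>\<in>P. norm (f \<theta> - xs \<theta>)) < e) \<longleftrightarrow> xs \<in> uniform_closure P ?K"
    if "continuous_on P xs" for xs
    unfolding uniform_closure_ct_states[OF P(2-4), symmetric]
    by (rule SUP_approx_iff_uniform_closure[OF P(2,1) that bdd_ct])
  have "a \<longleftrightarrow> (\<forall>xs. continuous_on P xs \<longrightarrow> (\<forall>e>0. \<exists>f\<in>?S. (SUP \<theta>\<in>P. norm (f \<theta> - xs \<theta>)) < e))"
    unfolding a_def ct_uniformly_ensemble_controllable_def bex_states
    by (simp only: conj_assoc ex_simps)
  also have "\<dots> \<longleftrightarrow> ?dense"
    unfolding dense by (intro iff_allI imp_cong refl ct)
  finally have a: "a \<longleftrightarrow> ?dense" .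
  have "b \<longleftrightarrow> (\<forall>xs. continuous_on P xs \<longrightarrow> (\<forall>e>0. \<exists>f\<in>?K. (SUP \<theta>\<in>P. norm (f \<theta> - xs \<theta>)) < e))"
    unfolding b_def dt_uniformly_ensemble_controllable_def dt_states_eq[symmetric] bex_states
    by (simp only: ex_simps)
  also have "\<dots> \<longleftrightarrow> ?dense"
    unfolding dense by (intro iff_allI imp_cong refl sup)
  finally have b: "b \<longleftrightarrow> ?dense" .
  have "c \<longleftrightarrow> (\<forall>e>0. \<forall>xs. continuous_on P xs \<longrightarrow> (\<exists>f\<in>?K. (SUP \<theta>\<in>P. norm (f \<theta> - xs \<theta>)) < e))"
    unfolding c_def range_poly_state_eq[symmetric] bex_simps(7) poly_state_def by (simp only: bex_UNIV)
  also have "\<dots> \<longleftrightarrow> ?dense"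
    unfolding dense swap by (intro iff_allI imp_cong refl sup)
  finally have c: "c \<longleftrightarrow> ?dense" .
  have "d \<longleftrightarrow> ?dense"
    unfolding d_def
    by (rule closure_of_cont_space_eq_iff[OF P(2,1) continuous_on_krylov_span[OF P(3,4)]])
  with a b c show ?thesis
    by blast
qed

end
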